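(* Suppose the gradient Lipschitz assumption (A1), the local strong concavity assumption (A2) and the bounded variance assumption (A3) stated in the context hold, with constants $L_{\theta\theta},L_{\theta x},L_{x\theta}>0$, $\mu>0$ and $\sigma^2>0$. Put $L = L_{\theta x}L_{x\theta}/\mu + L_{\theta\theta}$ and $\Delta = L_S(\theta^0)-\min_\theta L_S(\theta)$, where $\theta^0$ is the initial parameter. Let $T$ be a positive integer with $T\ge \Delta L/\sigma^2$, set the step size of the outer minimization to $\eta_t=\eta=\sqrt{\Delta/(TL\sigma^2)}$ for all $t$, and let $\theta^0,\theta^1,\dots,\theta^{T}$ be the iterates of adversarial training $\theta^{t+1}=\theta^t-\eta_t\,\hat g_t(\theta^t)$, $t=0,\dots,T-1$, where $\hat g_t$ is the approximate stochastic gradient computed on the $t$-th random mini-batch using $\delta$-approximate solutions of the inner maximization problems. Then $$\frac1T\sum_{t=0}^{T-1}\mathbb{E}\big[\|\nabla L_S(\theta^t)\|_2^2\big]\;\le\;4\sigma\sqrt{\frac{L\Delta}{T}}+\frac{2L_{\theta x}^2\,\delta}{\mu}.$$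
   Context: Setting. Let $(x_i^0,y_i)$, $i=1,\dots,n$, be data points with $x_i^0\in\mathbb{R}^d$ and labels $y_i$; let $\theta\in\mathbb{R}^p$ denote model parameters, $h_\theta$ the model and $\ell$ a loss function. Write $f_i(\theta,x)=\ell(h_\theta(x),y_i)$, a real-valued function differentiable in $\theta$ and in $x$. Fix $\epsilon>0$ and let $\mathcal{X}_i=\{x\in\mathbb{R}^d:\|x-x_i^0\|_\infty\le\epsilon\}$. Min-max objective. $L_S(\theta)=\frac1n\sum_{i=1}^n \bar f_i(\theta)$ with $\bar f_i(\theta)=\max_{x\in\mathcal{X}_i}f_i(\theta,x)=f_i(\theta,x_i^*(\theta))$, where $x_i^*(\theta)=\operatorname{argmax}_{x\in\mathcal{X}_i}f_i(\theta,x)$. Its gradient is $\nabla L_S(\theta)=\frac1n\sum_{i=1}^n\nabla\bar f_i(\theta)=\frac1n\sum_{i=1}^n\nabla_\theta f_i(\theta,x_i^*(\theta))$. It is assumed that $\min_\theta L_S(\theta)$ exists. $\delta$-approximate inner solutions. For $\delta\ge0$, a point $\hat x_i(\theta)\in\mathcal{X}_i$ is a $\delta$-approximate solution to $x_i^*(\theta)$ if $\max_{x\in\mathcal{X}_i}\langle x-\hat x_i(\theta),\nabla_x f_i(\theta,\hat x_i(\theta))\rangle\le\delta$. Stochastic gradients. For a nonempty mini-batch $\mathcal{B}\subseteq\{1,\dots,n\}$, the stochastic gradient is $g(\theta)=\frac1{|\mathcal{B}|}\sum_{i\in\mathcal{B}}\nabla\bar f_i(\theta)$ and the approximate stochastic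 gradient is $\hat g(\theta)=\frac1{|\mathcal{B}|}\sum_{i\in\mathcal{B}}\nabla_\theta f_i(\theta,\hat x_i(\theta))$, where each $\hat x_i(\theta)$ is a $\delta$-approximate solution to $x_i^*(\theta)$. At iteration $t$ a random mini-batch $\mathcal{B}_t$ is drawn (independently of the past), giving $g_t$ and $\hat g_t$. The mini-batch sampling is unbiased: $\mathbb{E}[g(\theta)]=\nabla L_S(\theta)$ for every $\theta$ (so $\mathbb{E}[g_t(\theta^t)\mid\theta^t]=\nabla L_S(\theta^t)$). The initial point $\theta^0$ is fixed, and expectations are over the mini-batch randomness. Assumption (A1). For every $i$ and all $\theta,\theta',x,x'$: $\sup_x\|\nabla_\theta f_i(\theta,x)-\nabla_\theta f_i(\theta',x)\|_2\le L_{\theta\theta}\|\theta-\theta'\|_2$; $\sup_\theta\|\nabla_\theta f_i(\theta,x)-\nabla_\theta f_i(\theta,x')\|_2\le L_{\theta x}\|x-x'\|_2$; $\sup_x\|\nabla_x f_i(\theta,x)-\nabla_x f_i(\theta',x)\|_2\le L_{x\theta}\|\theta-\theta'\|_2$. Assumption (A2). For every $i$, every $\theta$ and all $x_1,x_2\in\mathcal{X}_i$: $f_i(\theta,x_1)\le f_i(\theta,x_2)+\langle\nabla_x f_i(\theta,x_2),x_1-x_2\rangle-\frac\mu2\|x_1-x_2\|_2^2$. Assumption (A3). For every $\theta$: $\mathbb{E}[\|g(\theta)-\nabla L_S(\theta)\|_2^2]\le\sigma^2$. *)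

theory Defs
  imports "HOL-Analysis.Analysis" "HOL-Probability.Probability"
begin

text \<open>Where the function has no gradient, the value is unspecified.\<close>

definition grad :: "('a::real_inner \<Rightarrow> real) \<Rightarrow> 'a \<Rightarrow> 'a" where
  "grad F x = (THE D. GDERIV F x :> D)"

lemma grad_eqI:
  assumes "GDERIV F x :> D"
  shows "grad F x = D"
  unfolding grad_def
proof (rule the_equality)
  fix D' assume "GDERIV F x :> D'"
  with assms have "(\<lambda>h. inner h D') = (\<lambda>h. inner h D)"
    unfolding gderiv_def by (metis has_derivative_unique)
  then have "inner (D' - D) D' = inner (D' - D) D"
    by metis
  then have "inner (D' - D) (D' - D) = 0"
    by (simp add: inner_diff_right)
  then show "D' = D" by simp
qed (fact assms)

lemma differentiable_gderiv_grad:
  fixes F :: "'a::euclidean_space \<Rightarrow> real"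
  assumes "F differentiable (at x)"
  shows "GDERIV F x :> grad F x"
proof -
  from assms obtain F' where F': "(F has_derivative F') (at x)"
    unfolding differentiable_def by blast
  then have "linear F'" by (rule has_derivative_linear)
  then have "F' = (\<lambda>h. inner h (adjoint F' 1))"
    using adjoint_works[of F'] by fastforce
  with F' have "GDERIV F x :> adjoint F' 1"
    unfolding gderiv_def by simp
  then show ?thesis by (simp add: grad_eqI)
qed

text \<open>A sample function \<open>F\<close> takes the parameter first and the input second; these are its
  partial gradients.\<close>

definition grad_par :: "('p::real_inner \<Rightarrow> 'x \<Rightarrow> real) \<Rightarrow> 'p \<Rightarrow> 'x \<Rightarrow> 'p" where
  "grad_par F \<theta> x = grad (\<lambda>\<theta>'. F \<theta>' x) \<theta>"

definition grad_inp :: "('p \<Rightarrow> 'x::real_inner \<Rightarrow> real) \<Rightarrow> 'p \<Rightarrow> 'x \<Rightarrow> 'x" where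
  "grad_inp F \<theta> x = grad (\<lambda>x'. F \<theta> x') x"

definition linf_ball :: "'x::euclidean_space \<Rightarrow> real \<Rightarrow> 'x set" where
  "linf_ball c \<epsilon> = {x. infnorm (x - c) \<le> \<epsilon>}"

text \<open>The supremum is a maximum whenever \<open>X\<close> is compact and nonempty (such as an
  \<open>\<ell>\<^sub>\<infinity>\<close>-ball) and \<open>F \<theta>\<close> is continuous.\<close>

definition robust_loss :: "('p \<Rightarrow> 'x \<Rightarrow> real) \<Rightarrow> 'x set \<Rightarrow> 'p \<Rightarrow> real" where
  "robust_loss F X \<theta> = (SUP x\<in>X. F \<theta> x)"

definition adv_objective ::
    "nat \<Rightarrow> (nat \<Rightarrow> 'p \<Rightarrow> 'x \<Rightarrow> real) \<Rightarrow> (nat \<Rightarrow> 'x set) \<Rightarrow> 'p \<Rightarrow> real" where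
  "adv_objective n f X \<theta> = (1 / real n) * (\<Sum>i=1..n. robust_loss (f i) (X i) \<theta>)"

definition approx_inner_solution ::
    "real \<Rightarrow> ('p \<Rightarrow> 'x::real_inner \<Rightarrow> real) \<Rightarrow> 'x set \<Rightarrow> 'p \<Rightarrow> 'x \<Rightarrow> bool" where
  "approx_inner_solution \<delta> F X \<theta> z \<longleftrightarrow>
     z \<in> X \<and> (\<forall>x\<in>X. inner (x - z) (grad_inp F \<theta> z) \<le> \<delta>)"

definition batches :: "nat \<Rightarrow> nat set set" where
  "batches n = {B. B \<subseteq> {1..n} \<and> B \<noteq> {}}"

definition stoch_grad ::
    "(nat \<Rightarrow> 'p::real_inner \<Rightarrow> 'x \<Rightarrow> real) \<Rightarrow> (nat \<Rightarrow> 'x set) \<Rightarrow> nat set \<Rightarrow> 'p \<Rightarrow> 'p" where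
  "stoch_grad f X B \<theta> =
     (1 / real (card B)) *\<^sub>R (\<Sum>i\<in>B. grad (robust_loss (f i) (X i)) \<theta>)"

definition approx_stoch_grad ::
    "(nat \<Rightarrow> 'p::real_inner \<Rightarrow> 'x \<Rightarrow> real) \<Rightarrow> (nat \<Rightarrow> 'p \<Rightarrow> 'x) \<Rightarrow> nat set \<Rightarrow> 'p \<Rightarrow> 'p" where
  "approx_stoch_grad f xhat B \<theta> =
     (1 / real (card B)) *\<^sub>R (\<Sum>i\<in>B. grad_par (f i) \<theta> (xhat i \<theta>))"

end

theory Submission
  imports Defs
begin

text \<open>
  Strong concavity makes the inner maximiser unique and Lipschitz in the parameter, with constant
  \<open>L\<^sub>x\<^sub>\<theta> / \<mu>\<close>; a two-sided quadratic bound then yields Danskin's formula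
  \<open>\<nabla>(max\<^sub>x f)(\<theta>) = \<nabla>\<^sub>\<theta> f(\<theta>, x\<^sup>*(\<theta>))\<close>, so the objective is \<open>L\<close>-smooth. The same
  inequality bounds the distance of a \<open>\<delta>\<close>-approximate solution from \<open>x\<^sup>*(\<theta>)\<close> by \<open>sqrt (\<delta> / \<mu>)\<close>,
  hence the squared gradient error by \<open>L\<^sub>\<theta>\<^sub>x\<^sup>2 \<delta> / \<mu>\<close>. Stochastic gradient
  steps with such an error still decrease the objective in expectation. The approximate solutions need not depend
  measurably on the parameter, but only finitely many batch histories exist, so all random
  variables involved are finite-valued.
\<close>

section \<open>Smooth functions\<close>

text \<open>The descent lemma, obtained without integration: \<open>\<psi>\<close> is the gap
  between the two sides along the segment from \<open>x\<close> to \<open>y\<close>, and the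
  Lipschitz bound with Cauchy-Schwarz makes its derivative nonpositive on [0, 1].\<close>

lemma smooth_upper_bound:
  fixes F :: "'a::real_inner \<Rightarrow> real"
  assumes F: "\<And>x. GDERIV F x :> G x"
    and G: "\<And>x y. norm (G x - G y) \<le> K * norm (x - y)"
  shows "F y \<le> F x + inner (y - x) (G x) + K / 2 * (norm (y - x))\<^sup>2"
proof -
  define d where "d = y - x"
  define \<psi> where
    "\<psi> s = F (x + s *\<^sub>R d) - s * inner d (G x) - K / 2 * s\<^sup>2 * (norm d)\<^sup>2" for s
  have "\<psi> 1 \<le> \<psi> 0"
  proof (rule DERIV_nonpos_imp_nonincreasing[where f=\<psi>])
    fix s :: real assume s: "0 \<le> s" "s \<le> 1"
    have "((\<lambda>s. F (x + s *\<^sub>R d)) has_derivative (\<lambda>h. inner (h *\<^sub>R d) (G (x + s *\<^sub>R d)))) (at s)"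
      by (rule has_derivative_compose[where g=F and f="\<lambda>s. x + s *\<^sub>R d", OF _ F[unfolded gderiv_def]])
        (auto intro!: derivative_eq_intros)
    then have 1: "((\<lambda>s. F (x + s *\<^sub>R d)) has_real_derivative inner d (G (x + s *\<^sub>R d))) (at s)"
      by (simp add: has_field_derivative_def mult_commute_abs)
    have 2: "(\<psi> has_real_derivative
        inner d (G (x + s *\<^sub>R d)) - inner d (G x) - K * s * (norm d)\<^sup>2) (at s)"
      unfolding \<psi>_def by (auto intro!: derivative_eq_intros 1)
    have "inner d (G (x + s *\<^sub>R d) - G x) \<le> norm d * norm (G (x + s *\<^sub>R d) - G x)"
      by (rule norm_cauchy_schwarz)
    also have "\<dots> \<le> norm d * (K * norm (x + s *\<^sub>R d - x))"
      by (intro mult_left_mono G) auto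
    also have "\<dots> = K * s * (norm d)\<^sup>2"
      using s by (simp add: power2_eq_square)
    finally have 3: "inner d (G (x + s *\<^sub>R d)) - inner d (G x) - K * s * (norm d)\<^sup>2 \<le> 0"
      by (simp add: inner_diff_right)
    show "\<exists>z. (\<psi> has_real_derivative z) (at s) \<and> z \<le> 0"
      using 2 3 by blast
  qed simp
  then show ?thesis
    by (simp add: \<psi>_def d_def)
qed

lemma smooth_lower_bound:
  fixes F :: "'a::real_inner \<Rightarrow> real"
  assumes F: "\<And>x. GDERIV F x :> G x"
    and G: "\<And>x y. norm (G x - G y) \<le> K * norm (x - y)"
  shows "F x + inner (y - x) (G x) - K / 2 * (norm (y - x))\<^sup>2 \<le> F y"
proof -
  have "- F y \<le> - F x + inner (y - x) (- G x) + K / 2 * (norm (y - x))\<^sup>2"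
  proof (rule smooth_upper_bound)
    show "GDERIV (\<lambda>x. - F x) x :> - G x" for x
      using F[of x] by (auto simp: gderiv_def intro: derivative_eq_intros)
    show "norm (- G x - - G y) \<le> K * norm (x - y)" for x y
      using G[of x y] by (simp add: norm_minus_commute)
  qed
  then show ?thesis by simp
qed

text \<open>After division by \<open>norm (y - x)\<close> the remainder is at most
  \<open>C * norm (y - x)\<close>, which tends to 0. This identifies the gradient of a maximum over
  inputs, where the maximiser moves with the parameter and need not be differentiable.\<close>

lemma gderiv_of_quadratic_bound:
  fixes F :: "'a::real_inner \<Rightarrow> real"
  assumes bound: "\<And>y. \<bar>F y - F x - inner (y - x) D\<bar> \<le> C * (norm (y - x))\<^sup>2"
  shows "GDERIV F x :> D"
proof -
  have "((\<lambda>y. (F y - F x - inner (y - x) D) / norm (y - x)) \<longlongrightarrow> 0) (at x)"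
  proof (rule Lim_null_comparison)
    show "\<forall>\<^sub>F y in at x. norm ((F y - F x - inner (y - x) D) / norm (y - x)) \<le> C * norm (y - x)"
    proof (rule eventually_at_filter[THEN iffD2], rule always_eventually, intro allI impI)
      fix y assume "y \<noteq> x"
      then show "norm ((F y - F x - inner (y - x) D) / norm (y - x)) \<le> C * norm (y - x)"
        using bound[of y] by (simp add: divide_le_eq power2_eq_square mult.assoc)
    qed
    have "((\<lambda>y. C * norm (y - x)) \<longlongrightarrow> C * norm (x - x)) (at x)"
      by (intro tendsto_intros)
    then show "((\<lambda>y. C * norm (y - x)) \<longlongrightarrow> 0) (at x)" by simp
  qed
  from tendsto_norm_zero[OF this] show ?thesis
    unfolding gderiv_def has_derivative_iff_norm
    by (simp add: bounded_linear_inner_left)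
qed

lemma gderiv_at_minimum:
  fixes F :: "'a::real_inner \<Rightarrow> real"
  assumes F: "GDERIV F x :> D" and min: "\<And>y. F x \<le> F y"
  shows "D = 0"
proof -
  have "(\<lambda>h. inner h D) = (\<lambda>h. 0)"
    using F min unfolding gderiv_def
    by (intro differential_zero_maxmin[of x UNIV F]) auto
  then show ?thesis
    by (metis inner_eq_zero_iff)
qed

text \<open>A positive directional derivative toward \<open>x\<close> would let a short move in that
  direction increase \<open>F\<close>, and convexity keeps the moved point in
  \<open>X\<close>.\<close>

lemma gderiv_at_constrained_maximum:
  fixes F :: "'a::real_inner \<Rightarrow> real"
  assumes F: "GDERIV F a :> D" and X: "convex X" "a \<in> X" "x \<in> X"
    and max: "\<And>z. z \<in> X \<Longrightarrow> F z \<le> F a"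
  shows "inner (x - a) D \<le> 0"
proof (rule ccontr)
  assume pos: "\<not> inner (x - a) D \<le> 0"
  have "((\<lambda>s. F (a + s *\<^sub>R (x - a))) has_derivative (\<lambda>h. inner (h *\<^sub>R (x - a)) D)) (at 0)"
    by (rule has_derivative_compose[where g=F and f="\<lambda>s. a + s *\<^sub>R (x - a)"])
      (auto intro!: derivative_eq_intros F[unfolded gderiv_def])
  then have "((\<lambda>s. F (a + s *\<^sub>R (x - a))) has_real_derivative inner (x - a) D) (at 0)"
    by (simp add: has_field_derivative_def mult_commute_abs)
  then obtain d where d: "d > 0"
    "\<And>s. 0 < s \<Longrightarrow> s < d \<Longrightarrow> F (a + 0 *\<^sub>R (x - a)) < F (a + (0 + s) *\<^sub>R (x - a))"
    using DERIV_pos_inc_right pos by (metis not_le)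
  \<comment> \<open>Below \<open>d\<close>, so that \<open>F\<close> increases strictly; at most 1,
    so that the moved point is a convex combination of \<open>a\<close> and
    \<open>x\<close>.\<close>
  define s where "s = min (d / 2) 1"
  have s: "0 < s" "s < d" "s \<le> 1" using d(1) by (auto simp: s_def)
  have "(1 - s) *\<^sub>R a + s *\<^sub>R x \<in> X"
    using X s by (intro convexD) auto
  then have "a + s *\<^sub>R (x - a) \<in> X" by (simp add: algebra_simps)
  from max[OF this] d(2)[OF s(1,2)] show False by simp
qed

section \<open>Robust loss of a single sample\<close>

lemma compact_linf_ball: "compact (linf_ball c \<epsilon>)"
  unfolding compact_eq_bounded_closed
proof
  have "norm x \<le> norm c + sqrt DIM('a) * \<epsilon>" if "x \<in> linf_ball c \<epsilon>" for x :: 'a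
  proof -
    have "norm (x - c) \<le> sqrt DIM('a) * infnorm (x - c)"
      by (rule norm_le_infnorm)
    also have "\<dots> \<le> sqrt DIM('a) * \<epsilon>"
      using that by (intro mult_left_mono) (auto simp: linf_ball_def)
    finally show ?thesis
      using norm_triangle_ineq[of "x - c" c] by simp
  qed
  then show "bounded (linf_ball c \<epsilon>)"
    by (rule boundedI)
  show "closed (linf_ball c \<epsilon>)"
    unfolding linf_ball_def by (intro closed_Collect_le continuous_intros)
qed

lemma convex_linf_ball: "convex (linf_ball c \<epsilon>)"
proof (rule convexI)
  fix x y :: 'a and u v :: real
  assume *: "x \<in> linf_ball c \<epsilon>" "y \<in> linf_ball c \<epsilon>" "0 \<le> u" "0 \<le> v" "u + v = 1"
  then have c: "c = u *\<^sub>R c + v *\<^sub>R c"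
    by (metis scaleR_left_distrib scaleR_one)
  have "infnorm (u *\<^sub>R x + v *\<^sub>R y - c) = infnorm (u *\<^sub>R (x - c) + v *\<^sub>R (y - c))"
    by (subst c) (simp add: algebra_simps)
  also have "\<dots> \<le> infnorm (u *\<^sub>R (x - c)) + infnorm (v *\<^sub>R (y - c))"
    by (rule infnorm_triangle)
  also have "\<dots> = u * infnorm (x - c) + v * infnorm (y - c)"
    using * by (simp add: infnorm_mul)
  also have "\<dots> \<le> u * \<epsilon> + v * \<epsilon>"
    using * by (intro add_mono mult_left_mono) (auto simp: linf_ball_def)
  also have "\<dots> = \<epsilon>" using *(5) by (metis distrib_right mult_1)
  finally show "u *\<^sub>R x + v *\<^sub>R y \<in> linf_ball c \<epsilon>"
    by (simp add: linf_ball_def)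
qed

text \<open>The input set enters through compactness, which yields a maximiser, and convexity, which
  yields the variational inequality there.\<close>

locale robust_sample =
  fixes F :: "'p::euclidean_space \<Rightarrow> 'x::euclidean_space \<Rightarrow> real"
    and X :: "'x set" and Lpp Lpx Lxp \<mu> :: real
  assumes X: "compact X" "convex X" "X \<noteq> {}"
    and diff_par: "\<And>\<theta> x. (\<lambda>\<theta>'. F \<theta>' x) differentiable (at \<theta>)"
    and diff_inp: "\<And>\<theta> x. F \<theta> differentiable (at x)"
    and lip_par_par: "\<And>\<theta> \<theta>' x. norm (grad_par F \<theta> x - grad_par F \<theta>' x) \<le> Lpp * norm (\<theta> - \<theta>')"
    and lip_par_inp: "\<And>\<theta> x x'. norm (grad_par F \<theta> x - grad_par F \<theta> x') \<le> Lpx * norm (x - x')"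
    and lip_inp_par: "\<And>\<theta> \<theta>' x. norm (grad_inp F \<theta> x - grad_inp F \<theta>' x) \<le> Lxp * norm (\<theta> - \<theta>')"
    and strongly_concave: "\<And>\<theta> x z. x \<in> X \<Longrightarrow> z \<in> X \<Longrightarrow>
      F \<theta> x \<le> F \<theta> z + inner (grad_inp F \<theta> z) (x - z) - \<mu> / 2 * (norm (x - z))\<^sup>2"
    and constants: "0 \<le> Lpp" "0 \<le> Lpx" "0 \<le> Lxp" "0 < \<mu>"
begin

lemma gderiv_par: "GDERIV (\<lambda>\<theta>'. F \<theta>' x) \<theta> :> grad_par F \<theta> x"
  unfolding grad_par_def by (rule differentiable_gderiv_grad[OF diff_par])

lemma gderiv_inp: "GDERIV (F \<theta>) x :> grad_inp F \<theta> x"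
  unfolding grad_inp_def by (rule differentiable_gderiv_grad[OF diff_inp])

text \<open>A maximiser fixed by choice; \<open>worst_input_lipschitz\<close> shows that the choices
  nevertheless vary in a Lipschitz way with the parameter.\<close>

definition worst_input :: "'p \<Rightarrow> 'x" where
  "worst_input \<theta> = (SOME x. x \<in> X \<and> (\<forall>z\<in>X. F \<theta> z \<le> F \<theta> x))"

lemma worst_input: "worst_input \<theta> \<in> X" "z \<in> X \<Longrightarrow> F \<theta> z \<le> F \<theta> (worst_input \<theta>)"
proof -
  have "continuous_on X (F \<theta>)"
    using diff_inp by (intro continuous_at_imp_continuous_on ballI differentiable_imp_continuous_within)
  then have "\<exists>x. x \<in> X \<and> (\<forall>z\<in>X. F \<theta> z \<le> F \<theta> x)"
    using continuous_attains_sup[OF X(1,3)] by blast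
  then have "worst_input \<theta> \<in> X \<and> (\<forall>z\<in>X. F \<theta> z \<le> F \<theta> (worst_input \<theta>))"
    unfolding worst_input_def by (rule someI_ex)
  then show "worst_input \<theta> \<in> X" "z \<in> X \<Longrightarrow> F \<theta> z \<le> F \<theta> (worst_input \<theta>)" by auto
qed

lemma robust_loss_eq: "robust_loss F X \<theta> = F \<theta> (worst_input \<theta>)"
  unfolding robust_loss_def
  by (rule cSup_eq_maximum) (use worst_input in auto)

text \<open>Adding the strong concavity inequalities for the two orderings of \<open>z\<close> and
  the maximiser cancels the function values and turns two halves of \<open>\<mu>\<close> into
  \<open>\<mu>\<close>. Optimality discards the gradient term at the maximiser. The bound serves
  both for maximisers of other parameters and for approximate solutions.\<close>

lemma dist_worst_input:
  assumes z: "z \<in> X"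
  shows "\<mu> * (norm (worst_input \<theta> - z))\<^sup>2 \<le> inner (worst_input \<theta> - z) (grad_inp F \<theta> z)"
proof -
  let ?a = "worst_input \<theta>"
  have "inner (z - ?a) (grad_inp F \<theta> ?a) \<le> 0"
    by (rule gderiv_at_constrained_maximum[OF gderiv_inp X(2) worst_input(1) z worst_input(2)])
  then show ?thesis
    using strongly_concave[OF z worst_input(1), of \<theta> \<theta>] strongly_concave[OF worst_input(1) z, of \<theta> \<theta>]
    by (simp add: inner_commute norm_minus_commute)
qed

lemma worst_input_lipschitz:
  "norm (worst_input \<theta> - worst_input \<theta>') \<le> Lxp / \<mu> * norm (\<theta> - \<theta>')"
proof -
  let ?a = "worst_input \<theta>" and ?b = "worst_input \<theta>'"
  \<comment> \<open>Subtracting this nonpositive quantity from the previous bound leaves a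
    difference of input gradients at the same input \<open>?b\<close>, which the cross-Lipschitz
    assumption controls.\<close>
  have "inner (?a - ?b) (grad_inp F \<theta>' ?b) \<le> 0"
    by (rule gderiv_at_constrained_maximum[OF gderiv_inp X(2) worst_input(1) worst_input])
  then have "\<mu> * (norm (?a - ?b))\<^sup>2 \<le> inner (?a - ?b) (grad_inp F \<theta> ?b - grad_inp F \<theta>' ?b)"
    using dist_worst_input[OF worst_input(1), of \<theta> \<theta>'] by (simp add: inner_diff_right)
  also have "\<dots> \<le> norm (?a - ?b) * norm (grad_inp F \<theta> ?b - grad_inp F \<theta>' ?b)"
    by (rule norm_cauchy_schwarz)
  also have "\<dots> \<le> norm (?a - ?b) * (Lxp * norm (\<theta> - \<theta>'))"
    by (intro mult_left_mono lip_inp_par) auto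
  finally have "norm (?a - ?b) * (\<mu> * norm (?a - ?b)) \<le> norm (?a - ?b) * (Lxp * norm (\<theta> - \<theta>'))"
    by (simp add: power2_eq_square ac_simps)
  then have "\<mu> * norm (?a - ?b) \<le> Lxp * norm (\<theta> - \<theta>')"
    using constants by (cases "?a = ?b") auto
  then show ?thesis
    using constants by (simp add: field_simps)
qed

text \<open>The path first moves the input at fixed parameter, costing \<open>Lpx\<close> times the
  Lipschitz constant of the maximiser, then the parameter at fixed input, costing
  \<open>Lpp\<close>. This is the origin of the smoothness constant \<open>L\<close>.\<close>

lemma grad_par_worst_input_lipschitz:
  "norm (grad_par F \<theta> (worst_input \<theta>) - grad_par F \<theta>' (worst_input \<theta>'))
     \<le> (Lpx * Lxp / \<mu> + Lpp) * norm (\<theta> - \<theta>')"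
proof -
  have "norm (grad_par F \<theta> (worst_input \<theta>) - grad_par F \<theta>' (worst_input \<theta>'))
      \<le> norm (grad_par F \<theta> (worst_input \<theta>) - grad_par F \<theta> (worst_input \<theta>'))
        + norm (grad_par F \<theta> (worst_input \<theta>') - grad_par F \<theta>' (worst_input \<theta>'))"
    using norm_triangle_ineq[of "grad_par F \<theta> (worst_input \<theta>) - grad_par F \<theta> (worst_input \<theta>')"
      "grad_par F \<theta> (worst_input \<theta>') - grad_par F \<theta>' (worst_input \<theta>')"] by simp
  also have "\<dots> \<le> Lpx * norm (worst_input \<theta> - worst_input \<theta>') + Lpp * norm (\<theta> - \<theta>')"
    by (intro add_mono lip_par_inp lip_par_par)
  also have "\<dots> \<le> Lpx * (Lxp / \<mu> * norm (\<theta> - \<theta>')) + Lpp * norm (\<theta> - \<theta>')"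
    using constants by (intro add_mono mult_left_mono worst_input_lipschitz) auto
  finally show ?thesis by (simp add: algebra_simps)
qed

text \<open>Danskin's formula by sandwiching. From below, the old maximiser \<open>?a\<close> is a
  competitor at the new parameter; from above, the new maximiser \<open>?b\<close> is a competitor
  at the old one. Smoothness at a fixed input bounds both, and replacing \<open>?b\<close> by
  \<open>?a\<close> in the upper gradient costs only a quadratic term.\<close>

lemma gderiv_robust_loss: "GDERIV (robust_loss F X) \<theta> :> grad_par F \<theta> (worst_input \<theta>)"
proof (rule gderiv_of_quadratic_bound)
  fix \<theta>'
  let ?a = "worst_input \<theta>" and ?b = "worst_input \<theta>'"
  note up = smooth_upper_bound[where F="\<lambda>\<theta>. F \<theta> x" and G="\<lambda>\<theta>. grad_par F \<theta> x" for x,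
      OF gderiv_par lip_par_par]
  note lo = smooth_lower_bound[where F="\<lambda>\<theta>. F \<theta> x" and G="\<lambda>\<theta>. grad_par F \<theta> x" for x,
      OF gderiv_par lip_par_par]
  have "inner (\<theta>' - \<theta>) (grad_par F \<theta> ?b - grad_par F \<theta> ?a)
      \<le> norm (\<theta>' - \<theta>) * norm (grad_par F \<theta> ?b - grad_par F \<theta> ?a)"
    by (rule norm_cauchy_schwarz)
  also have "\<dots> \<le> norm (\<theta>' - \<theta>) * (Lpx * norm (?b - ?a))"
    by (intro mult_left_mono lip_par_inp) auto
  also have "\<dots> \<le> norm (\<theta>' - \<theta>) * (Lpx * (Lxp / \<mu> * norm (\<theta>' - \<theta>)))"
    using constants by (intro mult_left_mono worst_input_lipschitz) auto
  finally have mixed: "inner (\<theta>' - \<theta>) (grad_par F \<theta> ?b - grad_par F \<theta> ?a)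
      \<le> Lpx * Lxp / \<mu> * (norm (\<theta>' - \<theta>))\<^sup>2"
    by (simp add: power2_eq_square ac_simps)
  \<comment> \<open>The mixed term arises only in the upper estimate; its sign lets the lower
    estimate share the same constant.\<close>
  have "0 \<le> Lpx * Lxp / \<mu> * (norm (\<theta>' - \<theta>))\<^sup>2"
    using constants by auto
  then show "\<bar>robust_loss F X \<theta>' - robust_loss F X \<theta> - inner (\<theta>' - \<theta>) (grad_par F \<theta> ?a)\<bar>
      \<le> (Lpx * Lxp / \<mu> + Lpp / 2) * (norm (\<theta>' - \<theta>))\<^sup>2"
    using up[of \<theta>' ?b \<theta>] lo[of \<theta> ?a \<theta>'] worst_input(2)[OF worst_input(1), of \<theta> \<theta>']
      worst_input(2)[OF worst_input(1), of \<theta>' \<theta>] mixed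
    unfolding robust_loss_eq abs_le_iff inner_diff_right distrib_right by linarith
qed

lemma grad_robust_loss: "grad (robust_loss F X) \<theta> = grad_par F \<theta> (worst_input \<theta>)"
  by (rule grad_eqI[OF gderiv_robust_loss])

text \<open>Testing the \<open>\<delta>\<close>-condition at the true maximiser bounds the
  right-hand side of \<open>dist_worst_input\<close>, hence the distance to it; the Lipschitz bound
  in the input transfers this to the gradients.\<close>

lemma approx_inner_solution_grad_error:
  assumes z: "approx_inner_solution \<delta> F X \<theta> z"
  shows "norm (grad_par F \<theta> z - grad (robust_loss F X) \<theta>) \<le> Lpx * sqrt (\<delta> / \<mu>)"
proof -
  let ?a = "worst_input \<theta>"
  have "\<mu> * (norm (?a - z))\<^sup>2 \<le> \<delta>"
    using z dist_worst_input[of z \<theta>] worst_input(1)[of \<theta>]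
    unfolding approx_inner_solution_def by force
  then have "(norm (z - ?a))\<^sup>2 \<le> \<delta> / \<mu>"
    using constants by (simp add: field_simps norm_minus_commute)
  then have "norm (z - ?a) \<le> sqrt (\<delta> / \<mu>)"
    by (rule real_le_rsqrt)
  then have "Lpx * norm (z - ?a) \<le> Lpx * sqrt (\<delta> / \<mu>)"
    using constants by (intro mult_left_mono) auto
  then show ?thesis
    unfolding grad_robust_loss using lip_par_inp[of \<theta> z ?a] by linarith
qed

end

lemma norm_mean_le:
  assumes "\<And>i. i \<in> I \<Longrightarrow> norm (v i) \<le> c" and "0 \<le> c"
  shows "norm ((1 / real (card I)) *\<^sub>R (\<Sum>i\<in>I. v i)) \<le> c"
proof -
  have "norm (\<Sum>i\<in>I. v i) \<le> real (card I) * c"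
    using sum_norm_bound[of I v c] assms(1) by simp
  then show ?thesis
    \<comment> \<open>When the cardinality is 0, the factor \<open>1 / 0\<close> is 0 and the claim
      reduces to \<open>0 \<le> c\<close>.\<close>
    using assms(2) by (cases "card I = 0") (auto simp: field_simps)
qed

section \<open>Finite-valued random variables\<close>

context prob_space
begin

text \<open>Every function on a count space is measurable, and a finite range makes it bounded, so
  \<open>h\<close> may be arbitrary. This admits inner solvers with no regularity in the
  parameter.\<close>

lemma integrable_finite_valued:
  fixes h :: "'b \<Rightarrow> 'c::{banach,second_countable_topology}"
  assumes W: "W \<in> measurable M (count_space S)" and S: "finite S"
  shows "integrable M (\<lambda>\<omega>. h (W \<omega>))"
proof (rule integrable_const_bound)
  show "AE \<omega> in M. norm (h (W \<omega>)) \<le> (\<Sum>w\<in>S. norm (h w))"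
  proof (rule AE_I2)
    fix \<omega> assume "\<omega> \<in> space M"
    then have "W \<omega> \<in> S" using measurable_space[OF W] by simp
    then show "norm (h (W \<omega>)) \<le> (\<Sum>w\<in>S. norm (h w))"
      using S by (intro member_le_sum) auto
  qed
  show "(\<lambda>\<omega>. h (W \<omega>)) \<in> borel_measurable M"
    using W by (rule measurable_compose) simp
qed

lemma expectation_finite_valued:
  fixes h :: "'b \<Rightarrow> real"
  assumes W: "W \<in> measurable M (count_space S)" and S: "finite S"
  shows "expectation (\<lambda>\<omega>. h (W \<omega>)) = (\<Sum>w\<in>S. prob (W -` {w} \<inter> space M) * h w)"
proof -
  have ev: "W -` {w} \<inter> space M \<in> events" if "w \<in> S" for w
    using measurable_sets[OF W, of "{w}"] that by simp
  have "expectation (\<lambda>\<omega>. h (W \<omega>))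
      = expectation (\<lambda>\<omega>. \<Sum>w\<in>S. indicator (W -` {w} \<inter> space M) \<omega> * h w)"
  proof (rule Bochner_Integration.integral_cong)
    fix \<omega> assume \<omega>: "\<omega> \<in> space M"
    then have "W \<omega> \<in> S" using measurable_space[OF W] by simp
    then have "h (W \<omega>) = (\<Sum>w\<in>S. if w = W \<omega> then h w else 0)"
      using S by simp
    also have "\<dots> = (\<Sum>w\<in>S. indicator (W -` {w} \<inter> space M) \<omega> * h w)"
      using \<omega> by (intro sum.cong) (auto simp: indicator_def)
    finally show "h (W \<omega>) = (\<Sum>w\<in>S. indicator (W -` {w} \<inter> space M) \<omega> * h w)" .
  qed simp
  also have "\<dots> = (\<Sum>w\<in>S. prob (W -` {w} \<inter> space M) * h w)"
    using ev by (subst Bochner_Integration.integral_sum)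
      (auto intro!: sum.cong integrable_mult_left simp: emeasure_eq_measure Int_absorb2 sets.sets_into_space)
  finally show ?thesis .
qed

text \<open>A discrete substitute for conditioning on the past: a bound valid for each frozen value
  of \<open>Y\<close> survives averaging, since by independence the joint point probabilities factor
  and the weights of \<open>Y\<close> sum to 1.\<close>

lemma expectation_indep_le:
  fixes \<phi> :: "'b \<Rightarrow> 'b \<Rightarrow> real"
  assumes indep: "indep_var (count_space S) Y (count_space R) Z"
    and fin: "finite S" "finite R"
    and le: "\<And>y. y \<in> S \<Longrightarrow> expectation (\<lambda>\<omega>. \<phi> y (Z \<omega>)) \<le> c"
  shows "expectation (\<lambda>\<omega>. \<phi> (Y \<omega>) (Z \<omega>)) \<le> c"
proof -
  have Y: "Y \<in> measurable M (count_space S)" and Z: "Z \<in> measurable M (count_space R)"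
    using indep_var_rv1[OF indep] indep_var_rv2[OF indep] by auto
  have YZ: "(\<lambda>\<omega>. (Y \<omega>, Z \<omega>)) \<in> measurable M (count_space (S \<times> R))"
    using measurable_Pair[OF Y Z] fin
    by (simp add: pair_measure_countable countable_finite)
  let ?P = "\<lambda>y. prob (Y -` {y} \<inter> space M)" and ?Q = "\<lambda>z. prob (Z -` {z} \<inter> space M)"
  have "expectation (\<lambda>\<omega>. \<phi> (Y \<omega>) (Z \<omega>))
      = (\<Sum>(y, z)\<in>S \<times> R. prob ((\<lambda>\<omega>. (Y \<omega>, Z \<omega>)) -` {(y, z)} \<inter> space M) * \<phi> y z)"
    using expectation_finite_valued[OF YZ, of "\<lambda>(y, z). \<phi> y z"] fin by (simp add: case_prod_beta)
  also have "\<dots> = (\<Sum>(y, z)\<in>S \<times> R. ?P y * ?Q z * \<phi> y z)"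
    using indep_varD[OF indep, of "{y}" "{z}" for y z]
    by (intro sum.cong) auto
  also have "\<dots> = (\<Sum>y\<in>S. ?P y * (\<Sum>z\<in>R. ?Q z * \<phi> y z))"
    by (simp add: sum.cartesian_product[symmetric] sum_distrib_left mult.assoc)
  also have "\<dots> = (\<Sum>y\<in>S. ?P y * expectation (\<lambda>\<omega>. \<phi> y (Z \<omega>)))"
    by (simp add: expectation_finite_valued[OF Z fin(2)])
  also have "\<dots> \<le> (\<Sum>y\<in>S. ?P y * c)"
    by (intro sum_mono mult_left_mono le) auto
  also have "\<dots> = c"
    using expectation_finite_valued[OF Y fin(1), of "\<lambda>_. c"] by (simp add: prob_space)
  finally show ?thesis .
qed

end

section \<open>Inexact stochastic gradient descent\<close>

text \<open>The direction \<open>u\<close> splits into the exact gradient, the sampling noise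
  \<open>\<xi>\<close> and the solver error \<open>e\<close>. The product of gradient and noise is
  kept linear, so that unbiasedness can remove it in expectation; the products involving
  \<open>e\<close> are absorbed into squares.\<close>

lemma inexact_gradient_step:
  fixes S :: "'a::real_inner \<Rightarrow> real"
  assumes S: "\<And>x. GDERIV S x :> G x"
    and G: "\<And>x y. norm (G x - G y) \<le> L * norm (x - y)"
    and L: "0 \<le> L" and \<eta>: "0 \<le> \<eta>" "\<eta> * L \<le> 1"
  shows "S (x - \<eta> *\<^sub>R u) - S x + \<eta> / 2 * (norm (G x))\<^sup>2
    \<le> \<eta> / 2 * (1 + L * \<eta>) * (norm (u - g))\<^sup>2 + \<eta> * (1 - L * \<eta>) * inner (G x) (G x - g)
      + L * \<eta>\<^sup>2 * (norm (g - G x))\<^sup>2"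
proof -
  define e where "e = u - g"
  define \<xi> where "\<xi> = g - G x"
  have u: "u = G x + \<xi> + e" by (simp add: e_def \<xi>_def)
  have 1: "S (x - \<eta> *\<^sub>R u) \<le> S x - \<eta> * inner u (G x) + L / 2 * \<eta>\<^sup>2 * (norm u)\<^sup>2"
    using smooth_upper_bound[OF S G, of "x - \<eta> *\<^sub>R u" x] by (simp add: power_mult_distrib)
  \<comment> \<open>The weight given to this square is the total coefficient of
    \<open>inner (G x) e\<close>, nonnegative because \<open>\<eta> * L \<le> 1\<close>. With it,
    the squared gradient terms combine to exactly \<open>- \<eta> / 2\<close>.\<close>
  have "0 \<le> (norm (G x + e))\<^sup>2" by simp
  then have "- 2 * inner (G x) e \<le> (norm (G x))\<^sup>2 + (norm e)\<^sup>2"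
    by (simp add: power2_norm_eq_inner inner_add_left inner_add_right inner_commute)
  then have 2: "\<eta> / 2 * (1 - L * \<eta>) * (- 2 * inner (G x) e)
      \<le> \<eta> / 2 * (1 - L * \<eta>) * ((norm (G x))\<^sup>2 + (norm e)\<^sup>2)"
    using \<eta> by (intro mult_left_mono mult_nonneg_nonneg) (auto simp: mult.commute)
  \<comment> \<open>Absorbing the cross term doubles the noise coefficient from
    \<open>L * \<eta>\<^sup>2 / 2\<close> to \<open>L * \<eta>\<^sup>2\<close>.\<close>
  have "0 \<le> (norm (\<xi> - e))\<^sup>2" by simp
  then have "2 * inner \<xi> e \<le> (norm \<xi>)\<^sup>2 + (norm e)\<^sup>2"
    by (simp add: power2_norm_eq_inner inner_diff_left inner_diff_right inner_commute)
  then have 3: "L * \<eta>\<^sup>2 / 2 * (2 * inner \<xi> e) \<le> L * \<eta>\<^sup>2 / 2 * ((norm \<xi>)\<^sup>2 + (norm e)\<^sup>2)"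
    using L by (intro mult_left_mono) auto
  have 4: "inner u (G x) = (norm (G x))\<^sup>2 + inner (G x) \<xi> + inner (G x) e"
    by (simp add: u power2_norm_eq_inner inner_add_left inner_add_right inner_commute)
  have 5: "(norm u)\<^sup>2 = (norm (G x))\<^sup>2 + (norm \<xi>)\<^sup>2 + (norm e)\<^sup>2
      + 2 * inner (G x) \<xi> + 2 * inner (G x) e + 2 * inner \<xi> e"
    by (simp add: u power2_norm_eq_inner inner_add_left inner_add_right inner_commute)
  have 6: "inner (G x) (G x - g) = - inner (G x) \<xi>"
    by (simp add: \<xi>_def inner_diff_right)
  show ?thesis
    using 1 2 3 unfolding 4 5 6 e_def[symmetric] \<xi>_def[symmetric]
    by (simp add: field_simps power2_eq_square)
qed

text \<open>The iterate as a deterministic function of the batch sequence, of which only the entries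
  before \<open>t\<close> matter. It makes the random iterate a function of a finite-valued
  history.\<close>

primrec sgd_path :: "(nat \<Rightarrow> 'b \<Rightarrow> 'a \<Rightarrow> 'a::real_vector) \<Rightarrow> real \<Rightarrow> 'a \<Rightarrow> nat \<Rightarrow> (nat \<Rightarrow> 'b) \<Rightarrow> 'a" where
  "sgd_path u \<eta> v 0 H = v"
| "sgd_path u \<eta> v (Suc t) H = sgd_path u \<eta> v t H - \<eta> *\<^sub>R u t (H t) (sgd_path u \<eta> v t H)"

lemma sgd_path_cong:
  "(\<And>i. i < t \<Longrightarrow> H i = H' i) \<Longrightarrow> sgd_path u \<eta> v t H = sgd_path u \<eta> v t H'"
  by (induction t) auto

text \<open>The one-step estimate is averaged at a frozen parameter, transferred to the random
  iterate by independence, and then telescoped down to the lower bound \<open>m\<close>.\<close>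

lemma (in prob_space) inexact_sgd:
  fixes S :: "'b::euclidean_space \<Rightarrow> real"
  assumes S: "\<And>x. GDERIV S x :> G x"
    and G: "\<And>x y. norm (G x - G y) \<le> L * norm (x - y)"
    and L: "0 \<le> L" and \<eta>: "0 \<le> \<eta>" "\<eta> * L \<le> 1"
    and R: "finite R" and indep: "indep_vars (\<lambda>_. count_space R) B {..<T}"
    and unbiased: "\<And>t v. t < T \<Longrightarrow> expectation (\<lambda>\<omega>. g (B t \<omega>) v) = G v"
    and variance: "\<And>t v. t < T \<Longrightarrow> expectation (\<lambda>\<omega>. (norm (g (B t \<omega>) v - G v))\<^sup>2) \<le> V"
    and error: "\<And>t b v. t < T \<Longrightarrow> b \<in> R \<Longrightarrow> (norm (u t b v - g b v))\<^sup>2 \<le> E"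
    and iter_0: "\<And>\<omega>. \<omega> \<in> space M \<Longrightarrow> \<theta> 0 \<omega> = \<theta>0"
    and iter_Suc: "\<And>t \<omega>. t < T \<Longrightarrow> \<omega> \<in> space M \<Longrightarrow>
      \<theta> (Suc t) \<omega> = \<theta> t \<omega> - \<eta> *\<^sub>R u t (B t \<omega>) (\<theta> t \<omega>)"
    and lower: "\<And>x. m \<le> S x"
  shows "\<eta> / 2 * (\<Sum>t<T. expectation (\<lambda>\<omega>. (norm (G (\<theta> t \<omega>)))\<^sup>2))
    \<le> S \<theta>0 - m + real T * (\<eta> / 2 * (1 + L * \<eta>) * E + L * \<eta>\<^sup>2 * V)"
proof -
  define c where "c = \<eta> / 2 * (1 + L * \<eta>) * E + L * \<eta>\<^sup>2 * V"
  have B: "B t \<in> measurable M (count_space R)" if "t < T" for t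
    using indep that unfolding indep_vars_def by auto
  \<comment> \<open>Only batches strictly before \<open>t\<close> are recorded, so the history
    determines iterate \<open>t\<close> and is independent of \<open>B t\<close>.\<close>
  define hist where "hist t \<omega> = restrict (\<lambda>i. B i \<omega>) {..<t}" for t \<omega>
  define Hs where "Hs t = (PiE {..<t} (\<lambda>_. R))" for t :: nat
  have Hs: "finite (Hs t)" for t
    unfolding Hs_def using R by (intro finite_PiE) auto
  have PiM_eq: "PiM {..<t} (\<lambda>_. count_space R) = count_space (Hs t)" for t :: nat
    unfolding Hs_def using R by (intro count_space_PiM_finite) (auto simp: countable_finite)
  have hist: "hist t \<in> measurable M (count_space (Hs t))" if "t \<le> T" for t
    unfolding PiM_eq[symmetric] hist_def using that
    by (intro measurable_restrict B) auto
  have \<theta>: "\<theta> t \<omega> = sgd_path u \<eta> \<theta>0 t (hist t \<omega>)" if "t \<le> T" "\<omega> \<in> space M" for t \<omega>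
    using that(1)
  proof (induction t)
    case 0
    then show ?case using iter_0 that(2) by simp
  next
    case (Suc t)
    have "sgd_path u \<eta> \<theta>0 t (hist (Suc t) \<omega>) = sgd_path u \<eta> \<theta>0 t (hist t \<omega>)"
      by (rule sgd_path_cong) (simp add: hist_def)
    moreover have "hist (Suc t) \<omega> t = B t \<omega>"
      by (simp add: hist_def)
    ultimately show ?case
      using Suc iter_Suc[of t \<omega>] that(2) by simp
  qed
  have int: "integrable M (\<lambda>\<omega>. k (\<theta> t \<omega>))" if "t \<le> T" for t and k :: "'b \<Rightarrow> real"
    using integrable_finite_valued[OF hist[OF that] Hs, of "\<lambda>H. k (sgd_path u \<eta> \<theta>0 t H)"] \<theta> that
    by (subst Bochner_Integration.integrable_cong[OF refl]) auto
  have fixed: "expectation (\<lambda>\<omega>. S (v - \<eta> *\<^sub>R u t (B t \<omega>) v) - S v + \<eta> / 2 * (norm (G v))\<^sup>2) \<le> c"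
    if t: "t < T" for t v
  proof -
    note i = integrable_finite_valued[OF B[OF t] R]
    have "expectation (\<lambda>\<omega>. S (v - \<eta> *\<^sub>R u t (B t \<omega>) v) - S v + \<eta> / 2 * (norm (G v))\<^sup>2)
       \<le> expectation (\<lambda>\<omega>. \<eta> / 2 * (1 + L * \<eta>) * E + \<eta> * (1 - L * \<eta>) * inner (G v) (G v - g (B t \<omega>) v)
           + L * \<eta>\<^sup>2 * (norm (g (B t \<omega>) v - G v))\<^sup>2)"
    proof (rule integral_mono)
      fix \<omega> assume "\<omega> \<in> space M"
      then have b: "B t \<omega> \<in> R" using measurable_space[OF B[OF t]] by simp
      have "\<eta> / 2 * (1 + L * \<eta>) * (norm (u t (B t \<omega>) v - g (B t \<omega>) v))\<^sup>2 \<le> \<eta> / 2 * (1 + L * \<eta>) * E"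
        using L \<eta> by (intro mult_left_mono error[OF t b]) auto
      then show "S (v - \<eta> *\<^sub>R u t (B t \<omega>) v) - S v + \<eta> / 2 * (norm (G v))\<^sup>2
          \<le> \<eta> / 2 * (1 + L * \<eta>) * E + \<eta> * (1 - L * \<eta>) * inner (G v) (G v - g (B t \<omega>) v)
            + L * \<eta>\<^sup>2 * (norm (g (B t \<omega>) v - G v))\<^sup>2"
        using inexact_gradient_step[OF S G L \<eta>, of v "u t (B t \<omega>) v" "g (B t \<omega>) v"] by linarith
    qed (rule i)+
    also have "\<dots> = \<eta> / 2 * (1 + L * \<eta>) * E
        + \<eta> * (1 - L * \<eta>) * inner (G v) (G v - expectation (\<lambda>\<omega>. g (B t \<omega>) v))
        + L * \<eta>\<^sup>2 * expectation (\<lambda>\<omega>. (norm (g (B t \<omega>) v - G v))\<^sup>2)"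
    proof -
      have g: "integrable M (\<lambda>\<omega>. g (B t \<omega>) v)" by (rule i)
      have n: "integrable M (\<lambda>\<omega>. (norm (g (B t \<omega>) v - G v))\<^sup>2)" by (rule i)
      have "expectation (\<lambda>\<omega>. inner (G v) (G v - g (B t \<omega>) v))
          = inner (G v) (G v - expectation (\<lambda>\<omega>. g (B t \<omega>) v))"
        using g by (simp add: prob_space)
      then show ?thesis
        using g n by (simp add: prob_space del: inner_diff_right)
    qed
    \<comment> \<open>Unbiasedness annihilates the inner product, and the variance bound controls
      the remaining noise term.\<close>
    also have "\<dots> \<le> c"
      unfolding unbiased[OF t] c_def using L variance[OF t, of v]
      by (simp add: mult_left_mono)
    finally show ?thesis .
  qed
  have step: "\<eta> / 2 * expectation (\<lambda>\<omega>. (norm (G (\<theta> t \<omega>)))\<^sup>2)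
      \<le> expectation (\<lambda>\<omega>. S (\<theta> t \<omega>)) - expectation (\<lambda>\<omega>. S (\<theta> (Suc t) \<omega>)) + c"
    if t: "t < T" for t
  proof -
    \<comment> \<open>The current batch is packaged as a function on the singleton
      \<open>{t}\<close>, so that independence of restrictions to the disjoint index sets
      \<open>{..<t}\<close> and \<open>{t}\<close> applies.\<close>
    let ?Z = "\<lambda>\<omega>. restrict (\<lambda>i. B i \<omega>) {t}"
    have PiM_t: "PiM {t} (\<lambda>_. count_space R) = count_space (PiE {t} (\<lambda>_. R))"
      using R by (intro count_space_PiM_finite) (auto simp: countable_finite)
    have ind: "indep_var (count_space (Hs t)) (hist t) (count_space (PiE {t} (\<lambda>_. R))) ?Z"
      unfolding hist_def PiM_eq[symmetric] PiM_t[symmetric]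
      using t by (intro indep_var_restrict[OF indep]) auto
    let ?v = "sgd_path u \<eta> \<theta>0 t"
    have "expectation (\<lambda>\<omega>. S (?v (hist t \<omega>) - \<eta> *\<^sub>R u t (B t \<omega>) (?v (hist t \<omega>)))
        - S (?v (hist t \<omega>)) + \<eta> / 2 * (norm (G (?v (hist t \<omega>))))\<^sup>2) \<le> c"
      using expectation_indep_le[OF ind Hs, of
          "\<lambda>H z. S (?v H - \<eta> *\<^sub>R u t (z t) (?v H)) - S (?v H) + \<eta> / 2 * (norm (G (?v H)))\<^sup>2" c]
        fixed[OF t] R by (simp add: finite_PiE)
    also have "expectation (\<lambda>\<omega>. S (?v (hist t \<omega>) - \<eta> *\<^sub>R u t (B t \<omega>) (?v (hist t \<omega>)))
        - S (?v (hist t \<omega>)) + \<eta> / 2 * (norm (G (?v (hist t \<omega>))))\<^sup>2)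
      = expectation (\<lambda>\<omega>. S (\<theta> (Suc t) \<omega>) - S (\<theta> t \<omega>) + \<eta> / 2 * (norm (G (\<theta> t \<omega>)))\<^sup>2)"
      using t by (intro Bochner_Integration.integral_cong) (auto simp: \<theta>[of t] iter_Suc)
    also have "\<dots> = expectation (\<lambda>\<omega>. S (\<theta> (Suc t) \<omega>)) - expectation (\<lambda>\<omega>. S (\<theta> t \<omega>))
        + \<eta> / 2 * expectation (\<lambda>\<omega>. (norm (G (\<theta> t \<omega>)))\<^sup>2)"
      using int[of t S] int[of "Suc t" S] int[of t "\<lambda>x. (norm (G x))\<^sup>2"] t by simp
    finally show ?thesis by simp
  qed
  have "\<eta> / 2 * (\<Sum>t<T. expectation (\<lambda>\<omega>. (norm (G (\<theta> t \<omega>)))\<^sup>2))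
      \<le> (\<Sum>t<T. expectation (\<lambda>\<omega>. S (\<theta> t \<omega>)) - expectation (\<lambda>\<omega>. S (\<theta> (Suc t) \<omega>)) + c)"
    unfolding sum_distrib_left using step by (intro sum_mono) auto
  also have "\<dots> = expectation (\<lambda>\<omega>. S (\<theta> 0 \<omega>)) - expectation (\<lambda>\<omega>. S (\<theta> T \<omega>)) + real T * c"
    using sum_lessThan_telescope'[of "\<lambda>t. expectation (\<lambda>\<omega>. S (\<theta> t \<omega>))" T]
    by (simp add: sum.distrib del: sum_subtractf)
  also have "expectation (\<lambda>\<omega>. S (\<theta> 0 \<omega>)) = expectation (\<lambda>\<omega>. S \<theta>0)"
    by (intro Bochner_Integration.integral_cong) (auto simp: iter_0)
  also have "\<dots> = S \<theta>0" by (simp add: prob_space)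
  finally have "\<eta> / 2 * (\<Sum>t<T. expectation (\<lambda>\<omega>. (norm (G (\<theta> t \<omega>)))\<^sup>2))
      \<le> S \<theta>0 - expectation (\<lambda>\<omega>. S (\<theta> T \<omega>)) + real T * c" .
  moreover have "expectation (\<lambda>\<omega>. m) \<le> expectation (\<lambda>\<omega>. S (\<theta> T \<omega>))"
    using int[of T S] lower by (intro integral_mono) auto
  then have "m \<le> expectation (\<lambda>\<omega>. S (\<theta> T \<omega>))"
    by (simp add: prob_space)
  ultimately show ?thesis by (simp add: c_def)
qed

section \<open>Adversarial training\<close>

lemma finite_batches: "finite (batches n)"
  unfolding batches_def by simp

theorem theorem1:
  fixes n :: nat
    and x0 :: "nat \<Rightarrow> real ^ 'd"
    and y :: "nat \<Rightarrow> 'label"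
    and h :: "real ^ 'p \<Rightarrow> real ^ 'd \<Rightarrow> 'out"
    and loss :: "'out \<Rightarrow> 'label \<Rightarrow> real"
    and f :: "nat \<Rightarrow> real ^ 'p \<Rightarrow> real ^ 'd \<Rightarrow> real"
    and X :: "nat \<Rightarrow> (real ^ 'd) set"
    and LS :: "real ^ 'p \<Rightarrow> real"
    and \<theta>min \<theta>0 :: "real ^ 'p"
    and \<epsilon> \<delta> \<mu> \<sigma> \<eta> \<Delta> L L\<^sub>\<theta>\<^sub>\<theta> L\<^sub>\<theta>\<^sub>x L\<^sub>x\<^sub>\<theta> :: real
    and T :: nat
    and M :: "'w measure"
    and B :: "nat \<Rightarrow> 'w \<Rightarrow> nat set"
    and xhat :: "nat \<Rightarrow> nat \<Rightarrow> real ^ 'p \<Rightarrow> real ^ 'd"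
    and \<theta> :: "nat \<Rightarrow> 'w \<Rightarrow> real ^ 'p"
  assumes n: "n \<ge> 1"
    and eps: "\<epsilon> > 0"
    and f: "\<And>i \<theta> x. f i \<theta> x = loss (h \<theta> x) (y i)"
    and X: "\<And>i. X i = linf_ball (x0 i) \<epsilon>"
    and LS: "\<And>\<theta>. LS \<theta> = adv_objective n f X \<theta>"
    and diff_par: "\<And>i \<theta> x. i \<in> {1..n} \<Longrightarrow> (\<lambda>\<theta>'. f i \<theta>' x) differentiable (at \<theta>)"
    and diff_inp: "\<And>i \<theta> x. i \<in> {1..n} \<Longrightarrow> (\<lambda>x'. f i \<theta> x') differentiable (at x)"
    and minimum: "\<And>\<theta>. LS \<theta>min \<le> LS \<theta>"
    and constants: "L\<^sub>\<theta>\<^sub>\<theta> > 0" "L\<^sub>\<theta>\<^sub>x > 0" "L\<^sub>x\<^sub>\<theta> > 0" "\<mu> > 0" "\<sigma> > 0" "\<delta> \<ge> 0"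
    and A1_par_par: "\<And>i \<theta> \<theta>' x. i \<in> {1..n} \<Longrightarrow>
          norm (grad_par (f i) \<theta> x - grad_par (f i) \<theta>' x) \<le> L\<^sub>\<theta>\<^sub>\<theta> * norm (\<theta> - \<theta>')"
    and A1_par_inp: "\<And>i \<theta> x x'. i \<in> {1..n} \<Longrightarrow>
          norm (grad_par (f i) \<theta> x - grad_par (f i) \<theta> x') \<le> L\<^sub>\<theta>\<^sub>x * norm (x - x')"
    and A1_inp_par: "\<And>i \<theta> \<theta>' x. i \<in> {1..n} \<Longrightarrow>
          norm (grad_inp (f i) \<theta> x - grad_inp (f i) \<theta>' x) \<le> L\<^sub>x\<^sub>\<theta> * norm (\<theta> - \<theta>')"
    and A2: "\<And>i \<theta> x1 x2. i \<in> {1..n} \<Longrightarrow> x1 \<in> X i \<Longrightarrow> x2 \<in> X i \<Longrightarrow>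
          f i \<theta> x1 \<le> f i \<theta> x2 + inner (grad_inp (f i) \<theta> x2) (x1 - x2)
                       - \<mu> / 2 * (norm (x1 - x2))\<^sup>2"
    and M: "prob_space M"
    and batches: "prob_space.indep_vars M (\<lambda>_. count_space (batches n)) B {..<T}"
    and unbiased: "\<And>t \<theta>. t < T \<Longrightarrow>
          (\<integral>\<omega>. stoch_grad f X (B t \<omega>) \<theta> \<partial>M) = grad LS \<theta>"
    and A3: "\<And>t \<theta>. t < T \<Longrightarrow>
          (\<integral>\<omega>. (norm (stoch_grad f X (B t \<omega>) \<theta> - grad LS \<theta>))\<^sup>2 \<partial>M) \<le> \<sigma>\<^sup>2"
    and L: "L = L\<^sub>\<theta>\<^sub>x * L\<^sub>x\<^sub>\<theta> / \<mu> + L\<^sub>\<theta>\<^sub>\<theta>"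
    and \<Delta>: "\<Delta> = LS \<theta>0 - LS \<theta>min"
    and T: "T > 0" "real T \<ge> \<Delta> * L / \<sigma>\<^sup>2"
    and \<eta>: "\<eta> = sqrt (\<Delta> / (real T * L * \<sigma>\<^sup>2))"
    and xhat: "\<And>t i \<theta>. t < T \<Longrightarrow> i \<in> {1..n} \<Longrightarrow>
          approx_inner_solution \<delta> (f i) (X i) \<theta> (xhat t i \<theta>)"
    and iter_0: "\<And>\<omega>. \<omega> \<in> space M \<Longrightarrow> \<theta> 0 \<omega> = \<theta>0"
    and iter_Suc: "\<And>t \<omega>. t < T \<Longrightarrow> \<omega> \<in> space M \<Longrightarrow>
          \<theta> (Suc t) \<omega> = \<theta> t \<omega> - \<eta> *\<^sub>R approx_stoch_grad f (xhat t) (B t \<omega>) (\<theta> t \<omega>)"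
  shows "(1 / real T) * (\<Sum>t<T. (\<integral>\<omega>. (norm (grad LS (\<theta> t \<omega>)))\<^sup>2 \<partial>M))
           \<le> 4 * \<sigma> * sqrt (L * \<Delta> / real T) + 2 * L\<^sub>\<theta>\<^sub>x\<^sup>2 * \<delta> / \<mu>"
proof -
  interpret prob_space M by (rule M)
  have smp: "robust_sample (f i) (X i) L\<^sub>\<theta>\<^sub>\<theta> L\<^sub>\<theta>\<^sub>x L\<^sub>x\<^sub>\<theta> \<mu>" if i: "i \<in> {1..n}" for i
  proof
    show "compact (X i)" "convex (X i)"
      by (auto simp: X compact_linf_ball convex_linf_ball)
    show "X i \<noteq> {}"
      using eps by (auto simp: X linf_ball_def infnorm_0 intro!: exI[of _ "x0 i"])
  qed (use i constants diff_par diff_inp A1_par_par A1_par_inp A1_inp_par A2 in auto)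
  define G where "G \<theta> = (1 / real n) *\<^sub>R (\<Sum>i=1..n. grad (robust_loss (f i) (X i)) \<theta>)" for \<theta>
  have Lpos: "L > 0" using constants by (simp add: L add_pos_pos)
  have gd: "GDERIV LS \<theta> :> G \<theta>" for \<theta>
  proof -
    have "GDERIV (robust_loss (f i) (X i)) \<theta> :> grad (robust_loss (f i) (X i)) \<theta>"
      if i: "i \<in> {1..n}" for i
      using robust_sample.gderiv_robust_loss[OF smp[OF i]] robust_sample.grad_robust_loss[OF smp[OF i]]
      by simp
    then have "((\<lambda>\<theta>. (1 / real n) * (\<Sum>i=1..n. robust_loss (f i) (X i) \<theta>)) has_derivative
        (\<lambda>h. (1 / real n) * (\<Sum>i=1..n. inner h (grad (robust_loss (f i) (X i)) \<theta>)))) (at \<theta>)"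
      unfolding gderiv_def by (intro has_derivative_mult_right has_derivative_sum)
    then show ?thesis
      unfolding gderiv_def G_def LS[abs_def] adv_objective_def
      by (simp add: inner_sum_right)
  qed
  then have grad_LS: "grad LS \<theta> = G \<theta>" for \<theta> by (rule grad_eqI)
  have lip: "norm (G \<theta> - G \<theta>') \<le> L * norm (\<theta> - \<theta>')" for \<theta> \<theta>'
  proof -
    have "norm ((1 / real (card {1..n})) *\<^sub>R
        (\<Sum>i=1..n. grad (robust_loss (f i) (X i)) \<theta> - grad (robust_loss (f i) (X i)) \<theta>'))
      \<le> L * norm (\<theta> - \<theta>')"
    proof (rule norm_mean_le)
      show "norm (grad (robust_loss (f i) (X i)) \<theta> - grad (robust_loss (f i) (X i)) \<theta>')
        \<le> L * norm (\<theta> - \<theta>')" if i: "i \<in> {1..n}" for i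
        using robust_sample.grad_par_worst_input_lipschitz[OF smp[OF i]]
        by (simp add: L robust_sample.grad_robust_loss[OF smp[OF i]])
    qed (use Lpos in auto)
    then show ?thesis
      by (simp add: G_def sum_subtractf scaleR_diff_right)
  qed
  \<comment> \<open>The gradient errors are bounded per sample and averaging preserves the bound, so
    it holds for every batch and not merely in expectation.\<close>
  have err: "(norm (approx_stoch_grad f (xhat t) b v - stoch_grad f X b v))\<^sup>2 \<le> L\<^sub>\<theta>\<^sub>x\<^sup>2 * \<delta> / \<mu>"
    if t: "t < T" and b: "b \<in> batches n" for t b v
  proof -
    have "norm ((1 / real (card b)) *\<^sub>R
        (\<Sum>i\<in>b. grad_par (f i) v (xhat t i v) - grad (robust_loss (f i) (X i)) v))
      \<le> L\<^sub>\<theta>\<^sub>x * sqrt (\<delta> / \<mu>)"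
    proof (rule norm_mean_le)
      fix i assume "i \<in> b"
      then have i: "i \<in> {1..n}" using b by (auto simp: batches_def)
      show "norm (grad_par (f i) v (xhat t i v) - grad (robust_loss (f i) (X i)) v)
          \<le> L\<^sub>\<theta>\<^sub>x * sqrt (\<delta> / \<mu>)"
        by (rule robust_sample.approx_inner_solution_grad_error[OF smp[OF i] xhat[OF t i]])
    qed (use constants in auto)
    then have "norm (approx_stoch_grad f (xhat t) b v - stoch_grad f X b v) \<le> L\<^sub>\<theta>\<^sub>x * sqrt (\<delta> / \<mu>)"
      by (simp add: approx_stoch_grad_def stoch_grad_def sum_subtractf scaleR_diff_right)
    then have "(norm (approx_stoch_grad f (xhat t) b v - stoch_grad f X b v))\<^sup>2
        \<le> (L\<^sub>\<theta>\<^sub>x * sqrt (\<delta> / \<mu>))\<^sup>2"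
      by (intro power_mono) auto
    then show ?thesis
      using constants by (simp add: power_mult_distrib)
  qed
  define E where "E = L\<^sub>\<theta>\<^sub>x\<^sup>2 * \<delta> / \<mu>"
  have E: "0 \<le> E" using constants by (simp add: E_def)
  let ?A = "\<Sum>t<T. expectation (\<lambda>\<omega>. (norm (grad LS (\<theta> t \<omega>)))\<^sup>2)"
  have "\<Delta> \<ge> 0" using minimum by (simp add: \<Delta>)
  show ?thesis
  \<comment> \<open>With zero initial gap the step size is 0 and cannot be cancelled later. The
    iterates then stay at \<open>\<theta>0\<close>, a minimiser, where the gradient
    vanishes.\<close>
  proof (cases "\<Delta> = 0")
    case True
    have "\<theta> t \<omega> = \<theta>0" if "t \<le> T" "\<omega> \<in> space M" for t \<omega>
      using that by (induction t) (auto simp: iter_0 iter_Suc \<eta> True)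
    moreover have "grad LS \<theta>0 = 0"
      unfolding grad_LS using minimum True
      by (intro gderiv_at_minimum[OF gd]) (simp add: \<Delta>)
    ultimately have "expectation (\<lambda>\<omega>. (norm (grad LS (\<theta> t \<omega>)))\<^sup>2) = expectation (\<lambda>\<omega>. 0)" if "t < T" for t
      using that by (intro Bochner_Integration.integral_cong) auto
    then have "?A = 0" by simp
    then show ?thesis
      using E True by (simp add: E_def)
  next
    case False
    with \<open>\<Delta> \<ge> 0\<close> have \<Delta>_pos: "\<Delta> > 0" by simp
    have \<eta>_pos: "\<eta> > 0" using \<Delta>_pos T(1) Lpos constants by (simp add: \<eta>)
    have \<eta>_sq: "\<eta>\<^sup>2 = \<Delta> / (real T * L * \<sigma>\<^sup>2)"
      using \<Delta>_pos T(1) Lpos constants by (simp add: \<eta>)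
    \<comment> \<open>The lower bound on \<open>T\<close> is precisely what makes this square at
      most 1.\<close>
    have "(\<eta> * L)\<^sup>2 = \<Delta> * L / \<sigma>\<^sup>2 / real T"
      unfolding power_mult_distrib \<eta>_sq
      using Lpos by (simp add: field_simps power2_eq_square)
    also have "\<dots> \<le> 1\<^sup>2"
      using T by (simp add: pos_divide_le_eq del: divide_divide_eq_left)
    finally have "(\<eta> * L)\<^sup>2 \<le> 1\<^sup>2" .
    then have \<eta>L: "\<eta> * L \<le> 1"
      by (rule power2_le_imp_le) simp
    have main: "\<eta> / 2 * ?A \<le> LS \<theta>0 - LS \<theta>min
        + real T * (\<eta> / 2 * (1 + L * \<eta>) * E + L * \<eta>\<^sup>2 * \<sigma>\<^sup>2)"
      unfolding grad_LS
    proof (rule inexact_sgd[OF gd lip _ _ \<eta>L finite_batches batches])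
      show "expectation (\<lambda>\<omega>. stoch_grad f X (B t \<omega>) v) = G v" if "t < T" for t v
        using unbiased[OF that] by (simp add: grad_LS)
      show "expectation (\<lambda>\<omega>. (norm (stoch_grad f X (B t \<omega>) v - G v))\<^sup>2) \<le> \<sigma>\<^sup>2" if "t < T" for t v
        using A3[OF that] by (simp add: grad_LS)
    qed (use Lpos \<eta>_pos err minimum iter_0 iter_Suc in \<open>auto simp: E_def\<close>)
    \<comment> \<open>The step size balances the two contributions: in terms of \<open>r\<close>,
      which equals \<open>L * \<eta> * \<sigma>\<close>, both the initial gap and the accumulated
      noise are \<open>\<eta> * real T * \<sigma> * r\<close>. Together with the factor 1/2 on the
      left this gives the constant 4.\<close>
    define r where "r = sqrt (L * \<Delta> / real T)"
    have \<Delta>_eta: "\<Delta> = \<eta>\<^sup>2 * (real T * L * \<sigma>\<^sup>2)"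
      using \<eta>_sq T(1) Lpos constants by simp
    have r: "r = L * \<eta> * \<sigma>"
      unfolding r_def
    proof (rule real_sqrt_unique)
      show "(L * \<eta> * \<sigma>)\<^sup>2 = L * \<Delta> / real T"
        using T(1) by (subst \<Delta>_eta) (simp add: power2_eq_square)
    qed (use Lpos \<eta>_pos constants in auto)
    have \<Delta>_eq: "\<Delta> = \<eta> * (real T * (\<sigma> * r))"
      by (subst \<Delta>_eta) (simp add: r power2_eq_square)
    have "\<eta> * (?A / 2) \<le> \<eta> * (real T * (2 * (\<sigma> * r) + (1 + L * \<eta>) / 2 * E))"
    proof -
      have "L * \<eta>\<^sup>2 * \<sigma>\<^sup>2 = \<eta> * (\<sigma> * r)"
        by (simp add: r power2_eq_square)
      from main[folded \<Delta>, unfolded this] have "\<eta> / 2 * ?A \<le> \<eta> * (real T * (\<sigma> * r))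
          + real T * (\<eta> / 2 * (1 + L * \<eta>) * E + \<eta> * (\<sigma> * r))"
        using \<Delta>_eq by linarith
      then show ?thesis
        by (simp add: algebra_simps)
    qed
    then have "?A / 2 \<le> real T * (2 * (\<sigma> * r) + (1 + L * \<eta>) / 2 * E)"
      by (rule mult_left_le_imp_le) (rule \<eta>_pos)
    \<comment> \<open>Using \<open>L * \<eta> \<le> 1\<close> turns the error factor into
      \<open>E\<close>, which doubles to \<open>2 * E\<close> once the 1/2 on the left is
      cleared.\<close>
    also have "\<dots> \<le> real T * (2 * (\<sigma> * r) + (1 + 1) / 2 * E)"
      using E \<eta>L by (intro mult_left_mono add_left_mono mult_right_mono divide_right_mono) (auto simp: mult.commute)
    finally have "?A \<le> (4 * \<sigma> * r + 2 * E) * real T"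
      by (simp add: algebra_simps)
    then have "?A / real T \<le> 4 * \<sigma> * r + 2 * E"
      using T(1) by (simp add: pos_divide_le_eq)
    then show ?thesis
      by (simp add: r_def E_def mult.assoc)
  qed
qed

end
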